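(* Let $r\ge 3$ be an integer and let $k$ be a positive integer. Then $\mathrm{COV}(r,k)=k$.
   Context: A complete $r$-uniform $r$-partite hypergraph $K$ has a vertex set $V=V(K)$ partitioned into nonempty classes $V_1\cup\dots\cup V_r$, and its edges are exactly the sets containing one vertex from each class. A $k$-coloring of a hypergraph is an assignment of a color from $[k]=\{1,\dots,k\}$ to each edge (not all $k$ colors need be used). For an edge-colored hypergraph $H$, let $H_i$ be the subhypergraph on vertex set $V(H)$ consisting of the edges of color $i$. A hypergraph is connected if it has only one vertex or any two distinct vertices can be connected by a sequence of edges each intersecting the next; every hypergraph is uniquely partitioned into connected components (a component may be a single vertex). A monochromatic component of $H$ is (the vertex set of) a connected component of $H_i$ for some color $i$. Let $c(H)$ be the minimum integer $m$ such that $V(H)$ can be covered by $m$ monochromatic components of $H$. $\mathrm{COV}(r,k)$ is the maximum of $c(K)$ when $K$ ranges over all (not necessarily spanning, i.e. arbitrary) $k$-colorings of complete $r$-uniform $r$-partite hypergraphs. *)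

theory Defs
  imports Main "HOL-Library.FuncSet" "HOL-Library.Disjoint_Sets"
begin

(* A hypergraph is given by its vertex set V and its set E of edges (vertex sets). *)

definition edge_walk :: "'a set set \<Rightarrow> 'a \<Rightarrow> 'a \<Rightarrow> 'a set list \<Rightarrow> bool" where
  "edge_walk E u v es \<longleftrightarrow>
     es \<noteq> [] \<and> set es \<subseteq> E \<and> u \<in> hd es \<and> v \<in> last es \<and>
     (\<forall>i. Suc i < length es \<longrightarrow> es ! i \<inter> es ! Suc i \<noteq> {})"

definition connected_hypergraph :: "'a set \<Rightarrow> 'a set set \<Rightarrow> bool" where
  "connected_hypergraph V E \<longleftrightarrow>
     V \<noteq> {} \<and> (\<forall>u\<in>V. \<forall>v\<in>V. u \<noteq> v \<longrightarrow> (\<exists>es. edge_walk E u v es))"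

definition induced_edges :: "'a set set \<Rightarrow> 'a set \<Rightarrow> 'a set set" where
  "induced_edges E C = {e \<in> E. e \<subseteq> C}"

(* Components are the (vertex sets of) maximal connected subhypergraphs. *)
definition components_of_hypergraph :: "'a set \<Rightarrow> 'a set set \<Rightarrow> 'a set set" where
  "components_of_hypergraph V E =
     {C. C \<subseteq> V \<and> connected_hypergraph C (induced_edges E C) \<and>
         (\<forall>D. C \<subseteq> D \<and> D \<subseteq> V \<and> connected_hypergraph D (induced_edges E D) \<longrightarrow> D = C)}"

definition color_class :: "'a set set \<Rightarrow> ('a set \<Rightarrow> nat) \<Rightarrow> nat \<Rightarrow> 'a set set" where
  "color_class E f i = {e \<in> E. f e = i}"

definition mono_components ::
    "'a set \<Rightarrow> 'a set set \<Rightarrow> nat \<Rightarrow> ('a set \<Rightarrow> nat) \<Rightarrow> 'a set set" where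
  "mono_components V E k f =
     (\<Union>i\<in>{1..k}. components_of_hypergraph V (color_class E f i))"

definition coverable_by ::
    "'a set \<Rightarrow> 'a set set \<Rightarrow> nat \<Rightarrow> ('a set \<Rightarrow> nat) \<Rightarrow> nat \<Rightarrow> bool" where
  "coverable_by V E k f m \<longleftrightarrow>
     (\<exists>S. S \<subseteq> mono_components V E k f \<and> finite S \<and> card S = m \<and> V \<subseteq> \<Union>S)"

definition cover_number ::
    "'a set \<Rightarrow> 'a set set \<Rightarrow> nat \<Rightarrow> ('a set \<Rightarrow> nat) \<Rightarrow> nat" where
  "cover_number V E k f = (LEAST m. coverable_by V E k f m)"

definition is_vertex_classes :: "nat \<Rightarrow> (nat \<Rightarrow> 'a set) \<Rightarrow> bool" where
  "is_vertex_classes r P \<longleftrightarrow>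
     (\<forall>j\<in>{1..r}. finite (P j) \<and> P j \<noteq> {}) \<and> disjoint_family_on P {1..r}"

definition partite_vertices :: "nat \<Rightarrow> (nat \<Rightarrow> 'a set) \<Rightarrow> 'a set" where
  "partite_vertices r P = (\<Union>j\<in>{1..r}. P j)"

definition complete_partite_edges :: "nat \<Rightarrow> (nat \<Rightarrow> 'a set) \<Rightarrow> 'a set set" where
  "complete_partite_edges r P =
     {e. e \<subseteq> partite_vertices r P \<and> (\<forall>j\<in>{1..r}. card (e \<inter> P j) = 1)}"

(* Hypergraphs are finite, so up to isomorphism their vertices are natural numbers. *)
definition cover_numbers :: "nat \<Rightarrow> nat \<Rightarrow> nat set" where
  "cover_numbers r k =
     {cover_number (partite_vertices r P) (complete_partite_edges r P) k f | P f.
        is_vertex_classes r (P :: nat \<Rightarrow> nat set) \<and>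
        f \<in> complete_partite_edges r P \<rightarrow> {1..k}}"

definition COV :: "nat \<Rightarrow> nat \<Rightarrow> nat" where
  "COV r k = Max (cover_numbers r k)"

lemma edge_walk_append:
  assumes "edge_walk E u w es" "edge_walk E w v fs"
  shows "edge_walk E u v (es @ fs)"
proof -
  have "(es @ fs) ! i \<inter> (es @ fs) ! Suc i \<noteq> {}" if "Suc i < length (es @ fs)" for i
  proof -
    consider "Suc i < length es" | "Suc i = length es" | "length es \<le> i" by linarith
    then show ?thesis
    proof cases
      case 1 then show ?thesis using assms(1) by (auto simp: edge_walk_def nth_append)
    next
      case 2
      then have "i = length es - 1" "es \<noteq> []" "fs \<noteq> []" using that by auto
      then have "(es @ fs) ! i = last es" "(es @ fs) ! Suc i = hd fs"
        using 2 by (auto simp: nth_append last_conv_nth hd_conv_nth)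
      then show ?thesis using assms by (auto simp: edge_walk_def)
    next
      case 3
      then show ?thesis using assms(2) that by (auto simp: edge_walk_def nth_append Suc_diff_le)
    qed
  qed
  then show ?thesis using assms by (auto simp: edge_walk_def)
qed

lemma connected_union:
  assumes "connected_hypergraph C (induced_edges E C)" "connected_hypergraph D (induced_edges E D)"
    and w: "w \<in> C" "w \<in> D"
  shows "connected_hypergraph (C \<union> D) (induced_edges E (C \<union> D))"
proof -
  let ?E = "induced_edges E (C \<union> D)"
  have mono: "edge_walk ?E u v es" if "edge_walk (induced_edges E X) u v es" "X \<subseteq> C \<union> D" for u v es X
    using that by (auto simp: edge_walk_def induced_edges_def)
  have to_w: "u = w \<or> (\<exists>es. edge_walk ?E u w es)" "u = w \<or> (\<exists>es. edge_walk ?E w u es)"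
    if "u \<in> C \<union> D" for u
  proof -
    obtain X where X: "X \<subseteq> C \<union> D" "u \<in> X" "w \<in> X" "connected_hypergraph X (induced_edges E X)"
      using \<open>u \<in> C \<union> D\<close> assms by blast
    show "u = w \<or> (\<exists>es. edge_walk ?E u w es)" "u = w \<or> (\<exists>es. edge_walk ?E w u es)"
      using X mono[OF _ X(1)] unfolding connected_hypergraph_def by metis+
  qed
  show ?thesis unfolding connected_hypergraph_def
  proof (intro conjI ballI impI)
    show "C \<union> D \<noteq> {}" using w by auto
    fix u v assume uv: "u \<in> C \<union> D" "v \<in> C \<union> D" "u \<noteq> v"
    show "\<exists>es. edge_walk ?E u v es"
      using to_w(1)[OF uv(1)] to_w(2)[OF uv(2)] uv(3) edge_walk_append[of ?E u w _ v] by blast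
  qed
qed

lemma partition_on_components:
  assumes "finite V"
  shows "partition_on V (components_of_hypergraph V E)"
proof (rule partition_onI)
  show "\<Union> (components_of_hypergraph V E) = V"
  proof (intro equalityI subsetI)
    fix v assume v: "v \<in> V"
    define A where "A = {C. v \<in> C \<and> C \<subseteq> V \<and> connected_hypergraph C (induced_edges E C)}"
    have "finite A" by (rule finite_subset[of _ "Pow V"]) (use assms in \<open>auto simp: A_def\<close>)
    moreover have "{v} \<in> A" using v by (auto simp: A_def connected_hypergraph_def)
    ultimately have "\<exists>C\<in>A. {v} \<le> C \<and> (\<forall>D\<in>A. C \<le> D \<longrightarrow> C = D)"
      by (rule finite_has_maximal2)
    then obtain C where CA: "C \<in> A" and max: "\<forall>D\<in>A. C \<le> D \<longrightarrow> C = D" by blast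
    have C: "v \<in> C" "C \<subseteq> V" "connected_hypergraph C (induced_edges E C)"
      using CA by (simp_all add: A_def)
    have "D = C" if "C \<subseteq> D" "D \<subseteq> V" "connected_hypergraph D (induced_edges E D)" for D
    proof -
      have "D \<in> A" using that C(1) by (simp add: A_def subsetD)
      then show ?thesis using max that(1) by metis
    qed
    then have "C \<in> components_of_hypergraph V E"
      using C by (simp add: components_of_hypergraph_def)
    then show "v \<in> \<Union> (components_of_hypergraph V E)" using C(1) by auto
  qed (auto simp: components_of_hypergraph_def)
next
  fix C D assume CD: "C \<in> components_of_hypergraph V E" "D \<in> components_of_hypergraph V E" "C \<noteq> D"
  show "disjnt C D"
  proof (rule ccontr)
    assume "\<not> disjnt C D"
    then obtain w where "w \<in> C" "w \<in> D" by (auto simp: disjnt_def)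
    then have "connected_hypergraph (C \<union> D) (induced_edges E (C \<union> D))"
      using CD by (intro connected_union[of C E D w]) (simp_all add: components_of_hypergraph_def)
    moreover have "C \<union> D \<subseteq> V" using CD by (simp add: components_of_hypergraph_def)
    ultimately have "C \<union> D = C" "C \<union> D = D"
      using CD(1,2) by (simp_all add: components_of_hypergraph_def)
    then show False using CD by auto
  qed
next
  show "{} \<notin> components_of_hypergraph V E"
    by (auto simp: components_of_hypergraph_def connected_hypergraph_def)
qed

(* Covers exist, so the LEAST in cover_number is attained. *)
lemma coverable_by_exists:
  assumes "finite V" "k \<ge> 1"
  shows "\<exists>m. coverable_by V E k f m"
proof -
  let ?S = "components_of_hypergraph V (color_class E f 1)"
  have "partition_on V ?S" by (rule partition_on_components[OF assms(1)])
  then have "\<Union>?S = V" "finite ?S"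
    using finite_elements[OF assms(1)] by (simp_all add: partition_on_def)
  moreover have "?S \<subseteq> mono_components V E k f" using assms(2) by (auto simp: mono_components_def)
  ultimately show ?thesis unfolding coverable_by_def by blast
qed

end

theory Submission
  imports Defs
begin

text \<open>
  Upper bound: fix an edge and three of its vertices \<open>a\<close>, \<open>b\<close>, \<open>c\<close> from different classes. For each
  color \<open>i\<close> choose one component of color \<open>i\<close> containing at least two of \<open>a\<close>, \<open>b\<close>, \<open>c\<close>, if there is
  one; there cannot be two such. Any vertex \<open>x\<close> lies in an edge that contains at least two of \<open>a\<close>,
  \<open>b\<close>, \<open>c\<close>, so \<open>x\<close> is in the component chosen for the color of that edge.

  Lower bound: let one class have \<open>k\<close> vertices and all others a single one, and color each edge by
  its vertex in the large class. Then no monochromatic component contains two vertices of that class.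
\<close>

text \<open>An edge is connected on its own, so its union with a component that it meets is
  connected; maximality of the component then absorbs the edge.\<close>

lemma edge_subset_component:
  assumes C: "C \<in> components_of_hypergraph V E"
    and e: "e \<in> E" "e \<subseteq> V" and w: "w \<in> e" "w \<in> C"
  shows "e \<subseteq> C"
proof -
  have "edge_walk (induced_edges E e) u v [e]" if "u \<in> e" "v \<in> e" for u v
    using that e by (auto simp: edge_walk_def induced_edges_def)
  then have "connected_hypergraph e (induced_edges E e)"
    using w(1) unfolding connected_hypergraph_def by blast
  then have "connected_hypergraph (C \<union> e) (induced_edges E (C \<union> e))"
    using C w by (intro connected_union) (auto simp: components_of_hypergraph_def)
  moreover have "C \<subseteq> C \<union> e" "C \<union> e \<subseteq> V"
    using C e(2) by (auto simp: components_of_hypergraph_def)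
  ultimately have "C \<union> e = C"
    using C unfolding components_of_hypergraph_def by blast
  then show ?thesis by blast
qed

lemma finite_partite_vertices:
  "is_vertex_classes r P \<Longrightarrow> finite (partite_vertices r P)"
  by (auto simp: is_vertex_classes_def partite_vertices_def)

text \<open>Supplies edges through prescribed vertices; disjointness of the classes rules out a
  second vertex in any class.\<close>

lemma image_in_complete_partite_edges:
  assumes P: "is_vertex_classes r P" and q: "\<forall>j\<in>{1..r}. q j \<in> P j"
  shows "q ` {1..r} \<in> complete_partite_edges r P"
proof -
  have "q ` {1..r} \<inter> P j = {q j}" if j: "j \<in> {1..r}" for j
  proof -
    have "l = j" if "l \<in> {1..r}" "q l \<in> P j" for l
    proof (rule ccontr)
      assume "l \<noteq> j"
      then have "P l \<inter> P j = {}"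
        using P that(1) j by (auto simp: is_vertex_classes_def disjoint_family_on_def)
      then show False using q that by blast
    qed
    then show ?thesis using q j by blast
  qed
  moreover have "q ` {1..r} \<subseteq> partite_vertices r P"
    using q by (auto simp: partite_vertices_def)
  ultimately show ?thesis by (simp add: complete_partite_edges_def)
qed

lemma cover_number_le:
  assumes P: "is_vertex_classes r P" and r: "r \<ge> 3"
    and f: "f \<in> complete_partite_edges r P \<rightarrow> {1..k}"
  shows "cover_number (partite_vertices r P) (complete_partite_edges r P) k f \<le> k"
proof -
  let ?V = "partite_vertices r P" and ?E = "complete_partite_edges r P"
  let ?comps = "\<lambda>i. components_of_hypergraph ?V (color_class ?E f i)"
  have "\<forall>j\<in>{1..r}. \<exists>x. x \<in> P j"
    using P by (auto simp: is_vertex_classes_def)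
  then obtain p where p: "\<forall>j\<in>{1..r}. p j \<in> P j" by metis
  have "p j \<in> ?V" if "j \<in> {1..r}" for j
    using p that unfolding partite_vertices_def by blast
  then have pV: "p 1 \<in> ?V" "p 2 \<in> ?V" "p 3 \<in> ?V" using r by auto
  define K where "K i v = (SOME C. C \<in> ?comps i \<and> v \<in> C)" for i v
  have "\<exists>C. C \<in> ?comps i \<and> v \<in> C" if "v \<in> ?V" for i v
    using partition_on_components[OF finite_partite_vertices[OF P], of "color_class ?E f i"] that
    by (auto simp: partition_on_def)
  then have "K i v \<in> ?comps i \<and> v \<in> K i v" if "v \<in> ?V" for i v
    using that unfolding K_def by (metis (mono_tags, lifting) someI_ex)
  then have K: "\<And>i v. v \<in> ?V \<Longrightarrow> K i v \<in> ?comps i" "\<And>i v. v \<in> ?V \<Longrightarrow> v \<in> K i v"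
    by blast+
  \<comment> \<open>If the pair \<open>p 2\<close>, \<open>p 3\<close> is separated in color
    \<open>i\<close>, any pair in a common component involves \<open>p 1\<close>. If no pair is,
    \<open>K i (p 1)\<close> serves as a default.\<close>
  define Z where "Z i = (if p 2 \<in> K i (p 3) then K i (p 3) else K i (p 1))" for i
  let ?S = "Z ` {1..k}"
  have "x \<in> \<Union>?S" if x: "x \<in> ?V" for x
  proof -
    obtain j where j: "j \<in> {1..r}" "x \<in> P j" using x by (auto simp: partite_vertices_def)
    \<comment> \<open>Swapping \<open>x\<close> in for \<open>p j\<close> loses at most one of
      \<open>p 1\<close>, \<open>p 2\<close>, \<open>p 3\<close>.\<close>
    define e where "e = p(j := x) ` {1..r}"
    have eE: "e \<in> ?E"
      unfolding e_def using p j by (intro image_in_complete_partite_edges[OF P]) auto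
    have in_K: "e \<subseteq> K (f e) v" if "v \<in> ?V" "w \<in> e" "w \<in> K (f e) v" for v w
      using edge_subset_component[OF K(1)[OF that(1)] _ _ that(2,3)] eE
      by (auto simp: color_class_def complete_partite_edges_def)
    have xe: "x \<in> e" using j unfolding e_def by force
    have pe: "p l \<in> e" if "l \<in> {1..r}" "l \<noteq> j" for l
      using that unfolding e_def by force
    have "1 \<in> {1..r}" "2 \<in> {1..r}" "3 \<in> {1..r}" using r by auto
    moreover have "(1 \<noteq> j \<and> 2 \<noteq> j) \<or> (1 \<noteq> j \<and> 3 \<noteq> j) \<or> (2 \<noteq> j \<and> 3 \<noteq> j)" by auto
    ultimately consider "p 1 \<in> e" "p 2 \<in> e" | "p 1 \<in> e" "p 3 \<in> e" | "p 2 \<in> e" "p 3 \<in> e"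
      using pe by blast
    then have "e \<subseteq> Z (f e)"
    proof cases
      case 1
      \<comment> \<open>If \<open>Z (f e)\<close> is the component of \<open>p 3\<close>, it
        contains \<open>p 2\<close>, so \<open>e\<close> meets it there; otherwise \<open>e\<close>
        meets it in \<open>p 1\<close>.\<close>
      then show ?thesis
        using in_K[OF pV(1) 1(1)] in_K[OF pV(3) 1(2)] K(2)[OF pV(1)] by (simp add: Z_def)
    next
      case 2
      then show ?thesis
        using in_K[OF pV(1) 2(1)] in_K[OF pV(3) 2(2)] K(2)[OF pV(1)] K(2)[OF pV(3)]
        by (simp add: Z_def)
    next
      case 3
      then have "e \<subseteq> K (f e) (p 3)"
        using in_K[OF pV(3) 3(2)] K(2)[OF pV(3)] by simp
      then show ?thesis using 3 by (auto simp: Z_def)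
    qed
    then show ?thesis using xe f eE by blast
  qed
  moreover have "?S \<subseteq> mono_components ?V ?E k f"
    using K(1) pV by (auto simp: mono_components_def Z_def)
  \<comment> \<open>\<open>coverable_by\<close> asks for an exact cardinality, and \<open>Z\<close>
    may repeat a vertex set for different colors, hence \<open>card ?S\<close> rather than
    \<open>k\<close>.\<close>
  ultimately have "coverable_by ?V ?E k f (card ?S)"
    unfolding coverable_by_def by blast
  then have "cover_number ?V ?E k f \<le> card ?S"
    unfolding cover_number_def by (rule Least_le)
  also have "\<dots> \<le> k" using card_image_le[of "{1..k}" Z] by simp
  finally show ?thesis .
qed

lemma cover_number_attained:
  assumes "r \<ge> 3" "k \<ge> 1"
  shows "k \<in> cover_numbers r k"
proof -
  \<comment> \<open>The shift by \<open>k\<close> keeps the singleton classes off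
    \<open>{1..k}\<close>.\<close>
  define P where "P j = (if j = 1 then {1..k} else {k + j})" for j :: nat
  define f where "f e = the_elem (e \<inter> {1..k})" for e :: "nat set"
  let ?V = "partite_vertices r P" and ?E = "complete_partite_edges r P"
  have P: "is_vertex_classes r P"
    using assms by (auto simp: is_vertex_classes_def P_def disjoint_family_on_def)
  have e_single: "e \<inter> {1..k} = {f e}" if "e \<in> ?E" for e
  proof -
    have "card (e \<inter> P 1) = 1" using that assms by (auto simp: complete_partite_edges_def)
    then have "card (e \<inter> {1..k}) = 1" by (simp add: P_def)
    then obtain y where y: "e \<inter> {1..k} = {y}" by (rule card_1_singletonE)
    then show ?thesis by (simp add: f_def)
  qed
  then have f: "f \<in> ?E \<rightarrow> {1..k}" by blast
  have single: "u = v"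
    if C: "C \<in> mono_components ?V ?E k f" and uv: "u \<in> C" "v \<in> C" "u \<in> {1..k}" "v \<in> {1..k}"
    for C u v
  proof (rule ccontr)
    assume "u \<noteq> v"
    obtain i where "connected_hypergraph C (induced_edges (color_class ?E f i) C)"
      using C by (auto simp: mono_components_def components_of_hypergraph_def)
    then obtain es where es: "edge_walk (induced_edges (color_class ?E f i) C) u v es"
      using uv \<open>u \<noteq> v\<close> unfolding connected_hypergraph_def by blast
    \<comment> \<open>The end edges of the walk have color \<open>i\<close>, which is their vertex
      in \<open>{1..k}\<close>; this forces both \<open>u\<close> and \<open>v\<close> to be
      \<open>i\<close>.\<close>
    then have "hd es \<in> set es" "last es \<in> set es" "set es \<subseteq> color_class ?E f i"
      by (auto simp: edge_walk_def induced_edges_def)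
    then have "hd es \<in> ?E" "f (hd es) = i" "last es \<in> ?E" "f (last es) = i"
      by (simp_all add: color_class_def subset_iff)
    moreover have "u \<in> hd es" "v \<in> last es" using es by (auto simp: edge_walk_def)
    ultimately have "u \<in> {i}" "v \<in> {i}"
      using e_single[of "hd es"] e_single[of "last es"] uv(3,4) by (metis IntI)+
    then show False using \<open>u \<noteq> v\<close> by simp
  qed
  let ?c = "cover_number ?V ?E k f"
  obtain S where S: "S \<subseteq> mono_components ?V ?E k f" "finite S" "card S = ?c" "?V \<subseteq> \<Union>S"
    using LeastI_ex[OF coverable_by_exists[OF finite_partite_vertices[OF P] assms(2)], of ?E f]
    unfolding cover_number_def[symmetric] by (auto simp: coverable_by_def)
  have "{1..k} \<subseteq> ?V"
    using assms by (force simp: partite_vertices_def P_def)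
  then have "\<forall>u\<in>{1..k}. \<exists>C. C \<in> S \<and> u \<in> C" using S(4) by blast
  \<comment> \<open>By \<open>single\<close>, distinct vertices of the large class need distinct
    members of the cover.\<close>
  then obtain g where g: "\<forall>u\<in>{1..k}. g u \<in> S \<and> u \<in> g u" by metis
  have "inj_on g {1..k}"
  proof (rule inj_onI)
    fix u v assume uv: "u \<in> {1..k}" "v \<in> {1..k}" "g u = g v"
    then have "g u \<in> mono_components ?V ?E k f" "u \<in> g u" "v \<in> g u" using g S(1) by auto
    then show "u = v" using single uv by blast
  qed
  then have "card {1..k} \<le> card S"
    using g S(2) by (intro card_inj_on_le) auto
  then have "k = ?c" using cover_number_le[OF P assms(1) f] S(3) by simp
  then show ?thesis
    unfolding cover_numbers_def using P f by blast
qed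

text \<open>Finiteness and nonemptiness are included because \<open>Max\<close> in
  \<open>COV\<close> is meaningful only for such sets.\<close>

theorem theorem1p1:
  fixes r k :: nat
  assumes "r \<ge> 3" and "k \<ge> 1"
  shows "finite (cover_numbers r k) \<and> cover_numbers r k \<noteq> {} \<and> COV r k = k"
proof -
  have le: "\<forall>m\<in>cover_numbers r k. m \<le> k"
    using cover_number_le[OF _ assms(1)] by (auto simp: cover_numbers_def)
  then have fin: "finite (cover_numbers r k)"
    by (meson finite_atMost finite_subset atMost_iff subsetI)
  have mem: "k \<in> cover_numbers r k" by (rule cover_number_attained[OF assms])
  have "COV r k = k" unfolding COV_def using fin le mem by (intro Max_eqI) auto
  then show ?thesis using fin mem by blast
qed

end
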